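(* Let $(X,X_+,\mathcal{K},f)$ be an abstract state space, let $P:X\to X$ be a projection, and let $T:X\to X$ be a Markov operator with $PT=TP$. Then the following conditions are equivalent: (i) $T$ is uniformly $P$-ergodic, i.e. $\lim_{n\to\infty}\|T^n-P\|=0$; (ii) $TP=P$ and there exists $n_0\in\mathbb{N}$ such that $\delta_P(T^{n_0})<1$; (iii) $TP=P$ and $r(T-P)<1$.
   Context: Abstract state space: let $X$ be a real ordered vector space with cone $X_+=\{x\in X: x\ge 0\}$ which is generating ($X=X_+-X_+$), let $f$ be a strictly positive linear functional on $X$ ($f(x)>0$ for $x\ge 0$, $x\ne 0$), and let $\mathcal{K}=\{x\in X_+: f(x)=1\}$. Let $U$ be the convex hull of $\mathcal{K}\cup(-\mathcal{K})$ and $\|x\|=\inf\{\lambda\ge 0: x\in\lambda U\}$. $(X,X_+,\mathcal{K},f)$ is an abstract state space if this seminorm is a norm, $X$ is complete for it, and $X_+$ is closed. A Markov operator on $X$ is a linear operator $T:X\to X$ that is positive ($Tx\ge0$ for $x\ge0$) and satisfies $T(\mathcal{K})\subset\mathcal{K}$. A projection is a bounded linear operator $P$ on $X$ with $P^2=P$. Generalized Dobrushin ergodicity coefficient: for a bounded linear operator $S$ on $X$ and a non-trivial projection $P$, $$\delta_P(S)=\sup_{x\in N_P,\ x\neq0}\frac{\|Sx\|}{\|x\|},\qquad N_P=\{x\in X: Px=0\};$$ if $P=I$, one puts $\delta_P(S)=1$. Complexification: spectral notions are taken over $\mathbb{C}$. That is, $X$ is replaced by $\tilde X=X+iX$ with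 norm $\|x+iy\|_\infty=\sup_{0\le t\le 2\pi}\|x\cos t-y\sin t\|$, and a bounded operator $S$ on $X$ by its extension $x+iy\mapsto Sx+iSy$ (which has the same norm). $r(S)=\sup_{\lambda\in\sigma(S)}|\lambda|$ is the spectral radius.
   Formalization: The equivalence with (ii) is stated only for P ≠ I, because for T = P = I conditions (i) and (iii) hold while δ_I(I) = 1 makes (ii) fail; (i) ⇔ (iii) is stated for every projection P. *)

theory Defs
  imports "HOL-Analysis.Analysis"
begin

definition cone_base :: "('a::ordered_real_vector \<Rightarrow> real) \<Rightarrow> 'a set" where
  "cone_base f = {x. 0 \<le> x \<and> f x = 1}"

(* The infimum is taken in the extended reals, so that it is infinite (and not an
   unspecified real number) when no dilate of U contains x. *)
definition base_gauge :: "('a::ordered_real_vector \<Rightarrow> real) \<Rightarrow> 'a \<Rightarrow> ereal" where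
  "base_gauge f x =
     Inf (ereal ` {l. 0 \<le> l \<and>
       x \<in> (\<lambda>u. l *\<^sub>R u) ` (convex hull (cone_base f \<union> uminus ` cone_base f))})"

(* The gauge being a complete norm is expressed by requiring it to be the norm of
   the class banach, whose topology is the one in the closedness assumption.  In particular
   the gauge is finite everywhere, which excludes the zero space (there U is empty). *)
locale abstract_state_space =
  fixes f :: "'a::{banach, ordered_real_vector} \<Rightarrow> real"
  assumes linear_functional: "linear f"
    and strictly_positive: "\<And>x. 0 \<le> x \<Longrightarrow> x \<noteq> 0 \<Longrightarrow> 0 < f x"
    and generating: "\<And>x::'a. \<exists>a b. 0 \<le> a \<and> 0 \<le> b \<and> x = a - b"
    and norm_eq_gauge: "\<And>x. ereal (norm x) = base_gauge f x"
    and closed_cone: "closed {x::'a. 0 \<le> x}"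

definition markov_operator ::
    "('a::ordered_real_vector \<Rightarrow> real) \<Rightarrow> ('a \<Rightarrow> 'a) \<Rightarrow> bool" where
  "markov_operator f T \<longleftrightarrow>
     linear T \<and> (\<forall>x. 0 \<le> x \<longrightarrow> 0 \<le> T x) \<and> T ` cone_base f \<subseteq> cone_base f"

definition is_projection :: "('a::real_normed_vector \<Rightarrow> 'a) \<Rightarrow> bool" where
  "is_projection P \<longleftrightarrow> bounded_linear P \<and> P \<circ> P = P"

definition dobrushin_coeff ::
    "('a::real_normed_vector \<Rightarrow> 'a) \<Rightarrow> ('a \<Rightarrow> 'a) \<Rightarrow> real" where
  "dobrushin_coeff P S =
     (if P = id then 1 else (SUP x\<in>{x. P x = 0 \<and> x \<noteq> 0}. norm (S x) / norm x))"

definition uniformly_ergodic ::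
    "('a::real_normed_vector \<Rightarrow> 'a) \<Rightarrow> ('a \<Rightarrow> 'a) \<Rightarrow> bool" where
  "uniformly_ergodic P T \<longleftrightarrow> (\<lambda>n. onorm (\<lambda>x. (T ^^ n) x - P x)) \<longlonglongrightarrow> 0"

(* The complexification X + iX: the pair (x, y) stands for x + iy.  Addition is the
   componentwise one of the product type; the Euclidean norm of the product type is not used,
   cx_norm takes its place. *)

definition cx_scale :: "complex \<Rightarrow> 'a::real_vector \<times> 'a \<Rightarrow> 'a \<times> 'a" where
  "cx_scale c z =
     (Re c *\<^sub>R fst z - Im c *\<^sub>R snd z, Im c *\<^sub>R fst z + Re c *\<^sub>R snd z)"

definition cx_norm :: "'a::real_normed_vector \<times> 'a \<Rightarrow> real" where
  "cx_norm z = (SUP t\<in>{0..2 * pi}. norm (cos t *\<^sub>R fst z - sin t *\<^sub>R snd z))"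

definition cx_bounded_linear ::
    "('a::real_normed_vector \<times> 'a \<Rightarrow> 'a \<times> 'a) \<Rightarrow> bool" where
  "cx_bounded_linear R \<longleftrightarrow>
     (\<forall>z w. R (z + w) = R z + R w) \<and>
     (\<forall>c z. R (cx_scale c z) = cx_scale c (R z)) \<and>
     (\<exists>M. \<forall>z. cx_norm (R z) \<le> M * cx_norm z)"

definition cx_extend :: "('a \<Rightarrow> 'a) \<Rightarrow> 'a \<times> 'a \<Rightarrow> 'a \<times> 'a" where
  "cx_extend S = map_prod S S"

definition op_spectrum :: "('a::real_normed_vector \<Rightarrow> 'a) \<Rightarrow> complex set" where
  "op_spectrum S =
     {c. \<not> (\<exists>R. cx_bounded_linear R \<and>
             R \<circ> (\<lambda>z. cx_extend S z - cx_scale c z) = id \<and>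
             (\<lambda>z. cx_extend S z - cx_scale c z) \<circ> R = id)}"

definition op_spectral_radius :: "('a::real_normed_vector \<Rightarrow> 'a) \<Rightarrow> real" where
  "op_spectral_radius S = (SUP c\<in>op_spectrum S. cmod c)"

end

theory Submission
  imports Defs
begin

text \<open>
  If \<open>T P = P\<close>, then \<open>(T - P)\<^sup>n = T\<^sup>n - P = T\<^sup>n (I - P)\<close> for \<open>n > 0\<close>, so all three conditions say that the powers of
  \<open>S = T - P\<close> tend to zero in norm; for the Dobrushin coefficient this is submultiplicativity of
  \<open>\<parallel>S\<^sup>n\<parallel>\<close>.  The spectral condition needs a part of Gelfand's formula, for which an argument of Rickart
  avoids contour integrals: with \<open>c\<close> running over the \<open>n\<close> equidistant points of the circle of
  radius \<open>r\<close> and \<open>R(c) = (S - c)\<inverse>\<close>, the sum \<open>\<Sum> c R(c)\<close> equals \<open>n r\<^sup>n (S\<^sup>n - r\<^sup>n)\<inverse>\<close>.  It is close to \<open>-n I\<close>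
  if and only if \<open>S\<^sup>n/r\<^sup>n\<close> is small, and divided by \<open>n\<close> it is Lipschitz in \<open>r\<close> uniformly in \<open>n\<close> as long as the
  circle stays in a compact subset of the resolvent set.  Hence \<open>S\<^sup>n/r\<^sup>n \<rightarrow> 0\<close> propagates from large
  radii down to every circle that encloses the spectrum.
\<close>

section \<open>The complexified norm\<close>

interpretation cx: vector_space cx_scale
  by unfold_locales (auto simp: cx_scale_def algebra_simps)

text \<open>Without this bound the real-valued \<open>SUP\<close> in \<open>cx_norm\<close> would be
  an unspecified number.\<close>

lemma bdd_above_cx_norm:
  "bdd_above ((\<lambda>t. norm (cos t *\<^sub>R fst z - sin t *\<^sub>R snd z)) ` {0..2 * pi})"
proof (rule bdd_aboveI2)
  fix t :: real
  have "norm (cos t *\<^sub>R fst z) \<le> norm (fst z)" "norm (sin t *\<^sub>R snd z) \<le> norm (snd z)"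
    by (auto intro: mult_left_le_one_le)
  then show "norm (cos t *\<^sub>R fst z - sin t *\<^sub>R snd z) \<le> norm (fst z) + norm (snd z)"
    by (smt (verit) norm_triangle_ineq4)
qed

text \<open>In polar form, \<open>c\<close> being \<open>|c|\<close> times
  \<open>cos t + i sin t\<close>, the real part of \<open>c z\<close> is \<open>|c|\<close> times
  the vector at angle \<open>t\<close> in the supremum. This and \<open>cx_norm_leI\<close> trade
  angles for complex scalars and carry all further facts on \<open>cx_norm\<close>.\<close>

lemma norm_fst_cx_scale_le: "norm (fst (cx_scale c z)) \<le> cmod c * cx_norm z"
proof (cases "c = 0")
  case True
  then show ?thesis by simp
next
  case False
  have "(Re (sgn c))\<^sup>2 + (Im (sgn c))\<^sup>2 = 1"
    using False by (metis cmod_power2 norm_sgn one_power2)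
  then obtain t where t: "0 \<le> t" "t \<le> 2 * pi" "Re (sgn c) = cos t" "Im (sgn c) = sin t"
    using sincos_total_2pi_le by blast
  have c: "Re c = cmod c * cos t" "Im c = cmod c * sin t"
    using False by (simp_all flip: t(3,4))
  have "norm (cos t *\<^sub>R fst z - sin t *\<^sub>R snd z) \<le> cx_norm z"
    unfolding cx_norm_def using t by (intro cSUP_upper bdd_above_cx_norm) auto
  moreover have "fst (cx_scale c z) = cmod c *\<^sub>R (cos t *\<^sub>R fst z - sin t *\<^sub>R snd z)"
    by (simp add: cx_scale_def c scaleR_diff_right)
  ultimately show ?thesis by (simp add: mult_left_mono)
qed

lemma cx_norm_leI:
  assumes "\<And>u. cmod u = 1 \<Longrightarrow> norm (fst (cx_scale u z)) \<le> B"
  shows "cx_norm z \<le> B"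
  unfolding cx_norm_def
proof (rule cSUP_least)
  show "norm (cos t *\<^sub>R fst z - sin t *\<^sub>R snd z) \<le> B" for t
    using assms[of "cis t"] by (simp add: cx_scale_def)
qed auto

lemma cx_norm_nonneg [simp]: "0 \<le> cx_norm z"
  using order_trans[OF norm_ge_zero norm_fst_cx_scale_le[of 1 z]] by simp

lemma norm_fst_le_cx_norm: "norm (fst z) \<le> cx_norm z"
  using norm_fst_cx_scale_le[of 1 z] by simp

lemma norm_snd_le_cx_norm: "norm (snd z) \<le> cx_norm z"
  \<comment> \<open>Multiplication by \<open>- \<i>\<close> moves the imaginary part into the first
    component.\<close>
  using norm_fst_cx_scale_le[of "- \<i>" z] by (simp add: cx_scale_def)

lemma cx_norm_triangle: "cx_norm (z + w) \<le> cx_norm z + cx_norm w"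
proof (rule cx_norm_leI)
  fix u assume "cmod u = 1"
  then show "norm (fst (cx_scale u (z + w))) \<le> cx_norm z + cx_norm w"
    using norm_fst_cx_scale_le[of u z] norm_fst_cx_scale_le[of u w]
      norm_triangle_ineq[of "fst (cx_scale u z)" "fst (cx_scale u w)"]
    by (simp add: cx.scale_right_distrib)
qed

lemma cx_norm_zero [simp]: "cx_norm 0 = 0"
  using cx_norm_leI[of 0 0] by (intro antisym) auto

lemma cx_norm_scale: "cx_norm (cx_scale c z) = cmod c * cx_norm z"
proof -
  have le: "cx_norm (cx_scale c z) \<le> cmod c * cx_norm z" for c and z :: "'a \<times> 'a"
  proof (rule cx_norm_leI)
    show "norm (fst (cx_scale u (cx_scale c z))) \<le> cmod c * cx_norm z" if "cmod u = 1" for u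
      using norm_fst_cx_scale_le[of "u * c" z] that by (simp add: norm_mult)
  qed
  show ?thesis
  proof (cases "c = 0")
    case True
    then show ?thesis by simp
  next
    case False
    \<comment> \<open>The reverse inequality is \<open>le\<close> for \<open>inverse c\<close> and
      the vector \<open>cx_scale c z\<close>.\<close>
    have "cmod c * cx_norm z \<le> cmod c * (cmod (inverse c) * cx_norm (cx_scale c z))"
      using le[of "inverse c" "cx_scale c z"] False by (intro mult_left_mono) auto
    also have "\<dots> = cx_norm (cx_scale c z)"
      using False by (simp add: norm_inverse)
    finally show ?thesis using le[of c z] by simp
  qed
qed

lemma cx_norm_minus: "cx_norm (- z) = cx_norm z"
  using cx_norm_scale[of "-1" z] by simp

lemma cx_norm_triangle_diff: "cx_norm (z - w) \<le> cx_norm z + cx_norm w"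
  using cx_norm_triangle[of z "- w"] by (simp add: cx_norm_minus)

lemma cx_norm_triangle_sub: "cx_norm z \<le> cx_norm w + cx_norm (z - w)"
  using cx_norm_triangle[of w "z - w"] by simp

lemma cx_norm_sum_le: "cx_norm (sum g I) \<le> (\<Sum>i\<in>I. cx_norm (g i))"
proof (induction I rule: infinite_finite_induct)
  case (insert i I)
  then show ?case using cx_norm_triangle[of "g i" "sum g I"] by simp
qed auto

lemma cx_norm_real: "cx_norm (x, 0) = norm x"
proof (rule antisym)
  show "cx_norm (x, 0) \<le> norm x"
    by (rule cx_norm_leI) (auto simp: cx_scale_def intro: order_trans[OF mult_right_mono[OF abs_Re_le_cmod]])
  show "norm x \<le> cx_norm (x, 0)"
    using norm_fst_le_cx_norm[of "(x, 0)"] by simp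
qed

text \<open>Bounds in \<open>cx_norm\<close> thus pass to the product norm, whose completeness
  serves for the Neumann series below.\<close>

lemma norm_prod_le_cx_norm: "norm z \<le> 2 * cx_norm z"
  using norm_fst_le_cx_norm[of z] norm_snd_le_cx_norm[of z] norm_Pair_le[of "fst z" "snd z"]
  by simp

lemma cx_norm_le_0_iff: "cx_norm z \<le> 0 \<longleftrightarrow> z = 0"
  using norm_prod_le_cx_norm[of z] by (smt (verit) cx_norm_zero norm_le_zero_iff)

section \<open>Extension of real operators to the complexification\<close>

lemma cx_extend_scale:
  assumes "linear S" shows "cx_extend S (cx_scale c z) = cx_scale c (cx_extend S z)"
  using assms by (cases z) (simp add: cx_extend_def cx_scale_def linear_diff linear_add linear_scale)

lemma linear_cx_extend:
  assumes "linear S" shows "linear (cx_extend S)"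
  using assms
  by (intro linearI) (auto simp: cx_extend_def linear_add linear_scale)

lemma bounded_linear_cx_extend:
  assumes "bounded_linear S" shows "bounded_linear (cx_extend S)"
proof -
  have "cx_extend S = (\<lambda>z. (S (fst z), S (snd z)))"
    by (auto simp: cx_extend_def)
  then show ?thesis
    using assms by (auto intro!: bounded_linear_Pair bounded_linear_compose[of S] bounded_linear_fst bounded_linear_snd)
qed

lemma bounded_linear_cx_scale: "bounded_linear (cx_scale c)"
  unfolding cx_scale_def
  by (intro bounded_linear_Pair bounded_linear_sub bounded_linear_add
      bounded_linear_const_scaleR bounded_linear_fst bounded_linear_snd)

lemma cx_extend_id [simp]: "cx_extend id z = z" "cx_extend (\<lambda>x. x) z = z"
  by (cases z; simp add: cx_extend_def)+

text \<open>The extension commutes with multiplication by \<open>u\<close>, so the first component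
  of \<open>u S z\<close> is \<open>S\<close> applied to the first component of
  \<open>u z\<close>.\<close>

lemma cx_norm_extend_le:
  assumes "bounded_linear S" shows "cx_norm (cx_extend S z) \<le> onorm S * cx_norm z"
proof (rule cx_norm_leI)
  fix u assume u: "cmod u = 1"
  have "norm (S (fst (cx_scale u z))) \<le> onorm S * (cmod u * cx_norm z)"
    using onorm[OF assms] norm_fst_cx_scale_le[of u z] onorm_pos_le[OF assms]
    by (meson mult_left_mono order_trans)
  then show "norm (fst (cx_scale u (cx_extend S z))) \<le> onorm S * cx_norm z"
    using u by (simp add: cx_extend_scale[OF bounded_linear.linear[OF assms], symmetric])
      (simp add: cx_extend_def)
qed

section \<open>Norms of powers of an operator\<close>

lemma bounded_linear_funpow:
  fixes S :: "'a::real_normed_vector \<Rightarrow> 'a"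
  assumes "bounded_linear S" shows "bounded_linear (S ^^ n)"
proof (induction n)
  case (Suc n)
  then show ?case using assms by (simp add: bounded_linear_compose o_def)
qed (simp add: id_def)

lemma onorm_funpow_add:
  fixes S :: "'a::real_normed_vector \<Rightarrow> 'a"
  assumes "bounded_linear S" shows "onorm (S ^^ (m + n)) \<le> onorm (S ^^ m) * onorm (S ^^ n)"
  unfolding funpow_add by (rule onorm_compose) (rule bounded_linear_funpow[OF assms])+

text \<open>Division of \<open>n\<close> by \<open>m\<close> with remainder bounds
  \<open>a n\<close> by \<open>a m ^ (n div m)\<close> times one of the finitely many values
  \<open>a j\<close> with \<open>j < m\<close>.\<close>

lemma submultiplicative_tendsto_0:
  fixes a :: "nat \<Rightarrow> real"
  assumes pos: "\<And>n. 0 \<le> a n" and sub: "\<And>m n. a (m + n) \<le> a m * a n"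
    and m: "0 < m" "a m < 1"
  shows "a \<longlonglongrightarrow> 0"
proof -
  define C where "C = Max (a ` {..<m})"
  have C: "a j \<le> C" if "j < m" for j
    unfolding C_def using that by simp
  have "0 \<le> C" using C[OF m(1)] pos[of 0] by linarith
  have mult: "a (m * k + j) \<le> a m ^ k * a j" for k j
  proof (induction k)
    case (Suc k)
    have "a (m * Suc k + j) \<le> a m * a (m * k + j)"
      using sub[of m "m * k + j"] by (simp add: add.assoc)
    also have "\<dots> \<le> a m * (a m ^ k * a j)"
      using Suc pos by (intro mult_left_mono) auto
    finally show ?case by (simp add: mult.assoc)
  qed simp
  have bound: "a n \<le> a m ^ (n div m) * C" for n
  proof -
    have "a n \<le> a m ^ (n div m) * a (n mod m)"
      using mult[of "n div m" "n mod m"] by simp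
    also have "\<dots> \<le> a m ^ (n div m) * C"
      using C[of "n mod m"] m pos by (intro mult_left_mono) auto
    finally show ?thesis .
  qed
  have "filterlim (\<lambda>n. n div m) at_top sequentially"
    using m(1) by (rule filterlim_at_top_div_const_nat)
  moreover have "(\<lambda>k. a m ^ k * C) \<longlonglongrightarrow> 0"
    using m pos by (intro tendsto_mult_left_zero LIMSEQ_power_zero) simp
  ultimately have "(\<lambda>n. a m ^ (n div m) * C) \<longlonglongrightarrow> 0"
    by (rule filterlim_compose[rotated])
  then show ?thesis
    by (rule tendsto_sandwich[OF always_eventually always_eventually tendsto_const, rotated -1])
      (use pos bound in auto)
qed

text \<open>The weights \<open>r ^ n\<close> preserve submultiplicativity, so the limit follows from
  a single good exponent \<open>m\<close>.\<close>

lemma onorm_funpow_tendsto_0: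
  fixes S :: "'a::real_normed_vector \<Rightarrow> 'a"
  assumes S: "bounded_linear S" and m: "0 < m" "onorm (S ^^ m) < r ^ m" and r: "0 < r"
  shows "(\<lambda>n. onorm (S ^^ n) / r ^ n) \<longlonglongrightarrow> 0"
proof (rule submultiplicative_tendsto_0[OF _ _ m(1)])
  show "0 \<le> onorm (S ^^ n) / r ^ n" for n
    using r by (intro divide_nonneg_pos onorm_pos_le bounded_linear_funpow S) simp
  show "onorm (S ^^ (j + k)) / r ^ (j + k) \<le> onorm (S ^^ j) / r ^ j * (onorm (S ^^ k) / r ^ k)" for j k
    using r onorm_funpow_add[OF S, of j k] by (simp add: power_add divide_right_mono)
  show "onorm (S ^^ m) / r ^ m < 1"
    using m r by simp
qed

section \<open>Geometric sums and points on a circle\<close>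

definition cx_geom :: "('a::real_normed_vector \<Rightarrow> 'a) \<Rightarrow> complex \<Rightarrow> nat \<Rightarrow> 'a \<times> 'a \<Rightarrow> 'a \<times> 'a" where
  "cx_geom S c n z = (\<Sum>j<n. cx_scale (c ^ (n - 1 - j)) (cx_extend (S ^^ j) z))"

lemma cx_geom_Suc: "cx_geom S c (Suc n) z = cx_scale c (cx_geom S c n z) + cx_extend (S ^^ n) z"
proof -
  have "cx_scale (c ^ (n - j)) w = cx_scale c (cx_scale (c ^ (n - 1 - j)) w)"
    if "j < n" for j and w :: "'a \<times> 'a"
    using that by (simp flip: power_Suc add: Suc_diff_Suc)
  then have "(\<Sum>j<n. cx_scale (c ^ (n - j)) (cx_extend (S ^^ j) z))
      = (\<Sum>j<n. cx_scale c (cx_scale (c ^ (n - 1 - j)) (cx_extend (S ^^ j) z)))"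
    by (intro sum.cong) (simp_all only: lessThan_iff)
  then show ?thesis
    unfolding cx_geom_def cx.scale_sum_right by simp
qed

lemma cx_extend_Suc: "cx_extend (S ^^ Suc n) z = cx_extend S (cx_extend (S ^^ n) z)"
  by (cases z) (simp add: cx_extend_def)

lemma cx_extend_Suc': "cx_extend (S ^^ Suc n) z = cx_extend (S ^^ n) (cx_extend S z)"
  by (cases z) (simp add: cx_extend_def funpow_swap1)

lemma linear_funpow:
  fixes S :: "'a::real_vector \<Rightarrow> 'a"
  assumes "linear S" shows "linear (S ^^ n)"
proof (induction n)
  case (Suc n)
  then show ?case using assms by (simp only: funpow.simps linear_compose)
qed (simp add: linear_id[unfolded id_def])

text \<open>\<open>cx_geom S c n\<close> is the quotient of \<open>S^n - c^n\<close> by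
  \<open>S - c\<close>. The factorization is proved on both sides: with \<open>S - c\<close> applied
  last it transfers surjectivity to \<open>S - c\<close>, with \<open>S - c\<close> applied first a
  lower bound.\<close>

lemma cx_geom_right:
  assumes "linear S"
  shows "cx_extend S (cx_geom S c n z) - cx_scale c (cx_geom S c n z)
       = cx_extend (S ^^ n) z - cx_scale (c ^ n) z"
proof (induction n)
  case 0
  show ?case using linear_cx_extend[OF assms]
    by (simp add: cx_geom_def linear_0)
next
  case (Suc n)
  let ?G = "cx_geom S c n z"
  have "cx_extend S (cx_geom S c (Suc n) z) - cx_scale c (cx_geom S c (Suc n) z)
      = cx_scale c (cx_extend S ?G - cx_scale c ?G) + cx_extend (S ^^ Suc n) z
        - cx_scale c (cx_extend (S ^^ n) z)"
    using linear_cx_extend[OF assms] unfolding cx_geom_Suc cx_extend_Suc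
    by (simp add: linear_add cx_extend_scale[OF assms] cx.scale_right_distrib cx.scale_right_diff_distrib)
  also have "\<dots> = cx_extend (S ^^ Suc n) z - cx_scale (c ^ Suc n) z"
    unfolding Suc by (simp add: cx.scale_right_diff_distrib)
  finally show ?case .
qed

lemma cx_geom_left:
  assumes "linear S"
  shows "cx_geom S c n (cx_extend S z - cx_scale c z) = cx_extend (S ^^ n) z - cx_scale (c ^ n) z"
proof (induction n)
  case 0
  show ?case by (simp add: cx_geom_def)
next
  case (Suc n)
  have "cx_extend (S ^^ n) (cx_extend S z - cx_scale c z)
      = cx_extend (S ^^ Suc n) z - cx_scale c (cx_extend (S ^^ n) z)"
    using linear_cx_extend[OF linear_funpow[OF assms]] unfolding cx_extend_Suc'
    by (simp add: linear_diff cx_extend_scale[OF linear_funpow[OF assms]])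
  then show ?case
    unfolding cx_geom_Suc Suc by (simp add: cx.scale_right_diff_distrib del: funpow.simps)
qed

definition circle_point :: "real \<Rightarrow> nat \<Rightarrow> nat \<Rightarrow> complex" where
  "circle_point r n k = of_real r * cis (2 * pi * k / n)"

text \<open>Up to the factor \<open>r ^ m\<close> this is a geometric sum in an \<open>n\<close>-th
  root of unity, which vanishes unless that root is 1, that is, unless \<open>n\<close> divides
  \<open>m\<close>.\<close>

lemma sum_circle_points:
  fixes r :: real
  assumes "0 < n" "0 < m" "m \<le> n"
  shows "(\<Sum>k<n. circle_point r n k ^ m)
       = (if m = n then of_nat n * of_real r ^ n else 0)"
proof -
  let ?w = "cis (2 * pi * m / n)"
  have eq: "circle_point r n k ^ m = of_real r ^ m * ?w ^ k" for k
    by (simp add: circle_point_def power_mult_distrib Complex.DeMoivre mult_ac)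
  have w: "?w ^ n = 1"
    using assms(1) by (simp add: Complex.DeMoivre cis_multiple_2pi)
  have "?w = exp (2 * of_real pi * \<i> * of_nat m / of_nat n)"
    by (simp add: cis_conv_exp mult_ac)
  then have w1: "?w = 1 \<longleftrightarrow> n dvd m"
    using complex_root_unity_eq_1[of n m] assms(1) by simp
  show ?thesis
  proof (cases "m = n")
    case True
    then have "?w = 1" using w1 by simp
    then show ?thesis by (simp only: eq) (simp add: True)
  next
    case False
    then have "?w \<noteq> 1" using w1 assms by (auto dest: dvd_imp_le)
    then have "(\<Sum>k<n. ?w ^ k) = 0" using w by (simp add: sum_gp_strict)
    then show ?thesis using False by (simp only: eq flip: sum_distrib_left) simp
  qed
qed

lemma circle_point_power: "0 < n \<Longrightarrow> circle_point r n k ^ n = of_real (r ^ n)"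
  by (simp add: circle_point_def power_mult_distrib Complex.DeMoivre cis_multiple_2pi)

text \<open>The extra factor \<open>c\<close> turns the coefficient of \<open>S^j\<close> into
  \<open>c ^ (n - j)\<close>, with exponents from 1 to \<open>n\<close>. Summation over the circle
  leaves only the exponent \<open>n\<close>, that is \<open>j = 0\<close>.\<close>

lemma sum_cx_geom_circle:
  assumes "0 < n" "linear S"
  shows "(\<Sum>k<n. cx_scale (circle_point r n k) (cx_geom S (circle_point r n k) n z))
       = cx_scale (of_nat n * of_real r ^ n) z"
proof -
  let ?c = "circle_point r n"
  have "(\<Sum>k<n. cx_scale (?c k) (cx_geom S (?c k) n z))
      = (\<Sum>k<n. \<Sum>j<n. cx_scale (?c k ^ (n - j)) (cx_extend (S ^^ j) z))"
    unfolding cx_geom_def cx.scale_sum_right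
    by (intro sum.cong) (simp_all flip: power_Suc add: Suc_diff_Suc)
  also have "\<dots> = (\<Sum>j<n. cx_scale (\<Sum>k<n. ?c k ^ (n - j)) (cx_extend (S ^^ j) z))"
    by (subst sum.swap) (simp add: cx.scale_sum_left)
  also have "\<dots> = (\<Sum>j<n. if j = 0 then cx_scale (of_nat n * of_real r ^ n) z else 0)"
    using assms(1) by (intro sum.cong) (auto simp: sum_circle_points)
  also have "\<dots> = cx_scale (of_nat n * of_real r ^ n) z"
    using assms(1) by simp
  finally show ?thesis .
qed

section \<open>The resolvent set\<close>

abbreviation cx_char :: "('a::real_normed_vector \<Rightarrow> 'a) \<Rightarrow> complex \<Rightarrow> 'a \<times> 'a \<Rightarrow> 'a \<times> 'a" where
  "cx_char S c z \<equiv> cx_extend S z - cx_scale c z"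

lemma cx_char_scale:
  assumes "linear S" shows "cx_char S c (cx_scale d z) = cx_scale d (cx_char S c z)"
  by (simp add: cx_extend_scale[OF assms] cx.scale_right_diff_distrib mult.commute)

lemma linear_cx_char:
  assumes "linear S" shows "linear (cx_char S c)"
  using linear_cx_extend[OF assms] bounded_linear.linear[OF bounded_linear_cx_scale]
  by (rule linear_compose_sub)

text \<open>\<open>inv\<close> is a genuine inverse only for \<open>c\<close> outside the spectrum,
  where \<open>cx_char S c\<close> is bijective.\<close>

definition cx_resolvent :: "('a::real_normed_vector \<Rightarrow> 'a) \<Rightarrow> complex \<Rightarrow> 'a \<times> 'a \<Rightarrow> 'a \<times> 'a" where
  "cx_resolvent S c = inv (cx_char S c)"

text \<open>The bound on the inverse is restated as a lower bound for \<open>S - c\<close>, a form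
  that survives small changes of \<open>c\<close>.\<close>

lemma not_in_op_spectrumE:
  assumes "c \<notin> op_spectrum S"
  obtains M where "0 < M" "\<And>z. cx_norm z \<le> M * cx_norm (cx_char S c z)" "bij (cx_char S c)"
proof -
  obtain R where R: "cx_bounded_linear R" "R \<circ> cx_char S c = id" "cx_char S c \<circ> R = id"
    using assms by (auto simp: op_spectrum_def)
  obtain M where M: "\<And>z. cx_norm (R z) \<le> M * cx_norm z"
    using R(1) by (auto simp: cx_bounded_linear_def)
  \<comment> \<open>Passing to \<open>max M 1\<close> makes the constant positive.\<close>
  have "cx_norm z \<le> max M 1 * cx_norm (cx_char S c z)" for z
  proof -
    have "cx_norm z \<le> M * cx_norm (cx_char S c z)"
      using M[of "cx_char S c z"] fun_cong[OF R(2), of z] by simp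
    also have "\<dots> \<le> max M 1 * cx_norm (cx_char S c z)"
      by (intro mult_right_mono) auto
    finally show ?thesis .
  qed
  moreover have "bij (cx_char S c)"
    using R(2,3) o_bij by blast
  ultimately show thesis by (intro that[of "max M 1"]) auto
qed

text \<open>The lower bound yields both injectivity and the boundedness of the inverse.\<close>

lemma not_in_op_spectrumI:
  assumes S: "linear S" and surj: "surj (cx_char S c)"
    and M: "\<And>z. cx_norm z \<le> M * cx_norm (cx_char S c z)"
  shows "c \<notin> op_spectrum S"
proof -
  let ?H = "cx_char S c"
  note lin = linear_cx_char[OF S, of c]
  have "inj ?H"
    unfolding linear_injective_0[OF lin]
  proof (intro allI impI)
    show "z = 0" if "?H z = 0" for z
      using M[of z] that by (simp add: cx_norm_le_0_iff)
  qed
  then have eqI: "z = w" if "?H z = ?H w" for z w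
    using that by (rule injD)
  let ?R = "inv ?H"
  have HR: "?H (?R z) = z" for z
    by (rule surj_f_inv_f[OF surj])
  have "cx_bounded_linear ?R"
    unfolding cx_bounded_linear_def
  proof (intro conjI allI exI)
    show "?R (z + w) = ?R z + ?R w" for z w
      by (rule eqI) (simp only: HR linear_add[OF lin])
    show "?R (cx_scale d z) = cx_scale d (?R z)" for d z
      by (rule eqI) (simp only: HR cx_char_scale[OF S])
    show "cx_norm (?R z) \<le> M * cx_norm z" for z
      using M[of "?R z"] by (simp only: HR)
  qed
  moreover have "?R \<circ> ?H = id" using \<open>inj ?H\<close> by simp
  moreover have "?H \<circ> ?R = id" using surj by (simp add: surj_iff)
  ultimately show ?thesis by (auto simp: op_spectrum_def)
qed

text \<open>The solution is the Neumann series of \<open>A\<close> at \<open>w\<close>. The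
  contraction is measured in \<open>cx_norm\<close>, while convergence and the continuity of
  \<open>A\<close> refer to the product norm; the price is a factor 2.\<close>

lemma cx_contraction_surj:
  fixes A :: "'a::banach \<times> 'a \<Rightarrow> 'a \<times> 'a"
  assumes A: "bounded_linear A" and q: "0 \<le> q" "q < 1" and le: "\<And>z. cx_norm (A z) \<le> q * cx_norm z"
  shows "\<exists>z. z - A z = w"
proof -
  have pow: "cx_norm ((A ^^ n) w) \<le> q ^ n * cx_norm w" for n
  proof (induction n)
    case (Suc n)
    have "cx_norm ((A ^^ Suc n) w) \<le> q * cx_norm ((A ^^ n) w)"
      using le by simp
    also have "\<dots> \<le> q * (q ^ n * cx_norm w)"
      using Suc q by (intro mult_left_mono) auto
    finally show ?case by (simp add: mult.assoc)
  qed simp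
  have summable: "summable (\<lambda>n. (A ^^ n) w)"
  proof (rule summable_comparison_test)
    show "\<exists>N. \<forall>n\<ge>N. norm ((A ^^ n) w) \<le> q ^ n * (2 * cx_norm w)"
    proof (intro exI[of _ 0] allI impI)
      show "norm ((A ^^ n) w) \<le> q ^ n * (2 * cx_norm w)" for n
        using norm_prod_le_cx_norm[of "(A ^^ n) w"] pow[of n] by simp
    qed
    show "summable (\<lambda>n. q ^ n * (2 * cx_norm w))"
      using q by (intro summable_mult2 summable_geometric) simp
  qed
  have "A (\<Sum>n. (A ^^ n) w) = (\<Sum>n. (A ^^ Suc n) w)"
    using bounded_linear.suminf[OF A summable] by simp
  also have "\<dots> = (\<Sum>n. (A ^^ n) w) - w"
    using suminf_split_head[OF summable] by simp
  finally have "(\<Sum>n. (A ^^ n) w) - A (\<Sum>n. (A ^^ n) w) = w" by simp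
  then show ?thesis by blast
qed

lemma cx_geom_bounded:
  assumes S: "bounded_linear S"
  obtains M where "\<And>z. cx_norm (cx_geom S c n z) \<le> M * cx_norm z"
proof -
  have "cx_norm (cx_geom S c n z) \<le> (\<Sum>j<n. cmod (c ^ (n - 1 - j)) * onorm (S ^^ j)) * cx_norm z" for z
  proof -
    have "cx_norm (cx_geom S c n z) \<le> (\<Sum>j<n. cx_norm (cx_scale (c ^ (n - 1 - j)) (cx_extend (S ^^ j) z)))"
      unfolding cx_geom_def by (rule cx_norm_sum_le)
    also have "\<dots> \<le> (\<Sum>j<n. cmod (c ^ (n - 1 - j)) * (onorm (S ^^ j) * cx_norm z))"
      unfolding cx_norm_scale
      by (intro sum_mono mult_left_mono cx_norm_extend_le bounded_linear_funpow[OF S]) auto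
    finally show ?thesis by (simp add: sum_distrib_right mult.assoc)
  qed
  then show thesis by (rule that)
qed

text \<open>A Neumann series makes \<open>S^m - c^m\<close> surjective, and it is bounded below by
  \<open>|c|^m - \<parallel>S^m\<parallel>\<close>. Both properties pass to the factor
  \<open>S - c\<close>.\<close>

lemma not_in_op_spectrum_if_onorm_less:
  fixes S :: "'a::banach \<Rightarrow> 'a"
  assumes S: "bounded_linear S" and m: "0 < m" "onorm (S ^^ m) < cmod c ^ m"
  shows "c \<notin> op_spectrum S"
proof -
  note lin = bounded_linear.linear[OF S] and Sm = bounded_linear_funpow[OF S, of m]
  have "0 < cmod c ^ m" using m(2) onorm_pos_le[OF Sm] by linarith
  then have "c \<noteq> 0" using m(1) by (auto simp: power_0_left)
  have surj: "\<exists>z. cx_char S c z = w" for w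
  proof -
    define A where "A z = cx_scale (inverse (c ^ m)) (cx_extend (S ^^ m) z)" for z
    \<comment> \<open>This is the equation \<open>(S^m - c^m) z = w\<close> divided by
      \<open>- (c ^ m)\<close>.\<close>
    have "\<exists>z. z - A z = cx_scale (- inverse (c ^ m)) w"
    proof (rule cx_contraction_surj)
      show "bounded_linear A"
        unfolding A_def
        by (intro bounded_linear_compose[OF bounded_linear_cx_scale] bounded_linear_cx_extend Sm)
      show "0 \<le> onorm (S ^^ m) / cmod c ^ m" "onorm (S ^^ m) / cmod c ^ m < 1"
        using m onorm_pos_le[OF Sm] \<open>0 < cmod c ^ m\<close> by auto
      show "cx_norm (A z) \<le> onorm (S ^^ m) / cmod c ^ m * cx_norm z" for z
        using cx_norm_extend_le[OF Sm, of z] \<open>0 < cmod c ^ m\<close> \<open>c \<noteq> 0\<close>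
        by (simp add: A_def cx_norm_scale norm_divide norm_power field_simps)
    qed
    then obtain z where z: "z - A z = cx_scale (- inverse (c ^ m)) w" ..
    have "cx_scale (- (c ^ m)) (z - A z) = cx_extend (S ^^ m) z - cx_scale (c ^ m) z"
      using \<open>c \<noteq> 0\<close> by (simp add: A_def cx.scale_right_diff_distrib)
    then have "cx_extend (S ^^ m) z - cx_scale (c ^ m) z = w"
      using \<open>c \<noteq> 0\<close> by (simp add: z)
    then show ?thesis using cx_geom_right[OF lin, of c m z] by metis
  qed
  obtain M where M: "\<And>z. cx_norm (cx_geom S c m z) \<le> M * cx_norm z"
    using cx_geom_bounded[OF S] by blast
  define d where "d = cmod c ^ m - onorm (S ^^ m)"
  have "d > 0" using m by (simp add: d_def)
  have "cx_norm z \<le> M / d * cx_norm (cx_char S c z)" for z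
  proof -
    have "cmod c ^ m * cx_norm z = cx_norm (cx_scale (c ^ m) z)"
      by (simp add: cx_norm_scale norm_power)
    also have "\<dots> \<le> cx_norm (cx_extend (S ^^ m) z) + cx_norm (cx_extend (S ^^ m) z - cx_scale (c ^ m) z)"
      using cx_norm_triangle_diff[of "cx_extend (S ^^ m) z" "cx_extend (S ^^ m) z - cx_scale (c ^ m) z"]
      by simp
    also have "\<dots> \<le> onorm (S ^^ m) * cx_norm z + M * cx_norm (cx_char S c z)"
      using cx_norm_extend_le[OF Sm, of z] M[of "cx_char S c z"] unfolding cx_geom_left[OF lin]
      by (rule add_mono)
    finally have "d * cx_norm z \<le> M * cx_norm (cx_char S c z)"
      by (simp add: d_def algebra_simps)
    then show ?thesis using \<open>d > 0\<close> by (simp add: field_simps)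
  qed
  moreover have "surj (cx_char S c)"
    unfolding surj_def using surj by metis
  ultimately show ?thesis
    by (intro not_in_op_spectrumI[OF lin])
qed

text \<open>The lower bound at \<open>c\<close> with constant \<open>M c\<close> persists on the
  ball of radius \<open>1 / (2 * M c)\<close> with the doubled constant. A finite subcover makes it
  uniform.\<close>

lemma cx_char_bounded_below_on_compact:
  fixes S :: "'a::real_normed_vector \<Rightarrow> 'a"
  assumes "compact K" "K \<inter> op_spectrum S = {}"
  obtains M where "0 < M" "\<And>c z. c \<in> K \<Longrightarrow> cx_norm z \<le> M * cx_norm (cx_char S c z)"
proof -
  have "\<exists>M>0. \<forall>z. cx_norm z \<le> M * cx_norm (cx_char S c z)" if "c \<in> K" for c
    using not_in_op_spectrumE[of c S] that assms(2) by (metis disjoint_iff)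
  then obtain M where M: "\<And>c. c \<in> K \<Longrightarrow> 0 < M c"
      "\<And>c z. c \<in> K \<Longrightarrow> cx_norm z \<le> M c * cx_norm (cx_char S c z)"
    by metis
  have "K \<subseteq> (\<Union>c\<in>K. ball c (1 / (2 * M c)))"
    using M(1) by force
  then obtain C where C: "C \<subseteq> K" "finite C" "K \<subseteq> (\<Union>c\<in>C. ball c (1 / (2 * M c)))"
    using compactE_image[OF assms(1), of K "\<lambda>c. ball c (1 / (2 * M c))"] by blast
  \<comment> \<open>The sum dominates every \<open>2 * M c\<close>; the summand 1 keeps
    \<open>B\<close> positive when \<open>C\<close> is empty.\<close>
  define B where "B = 1 + (\<Sum>c\<in>C. 2 * M c)"
  have nonneg: "0 \<le> 2 * M c" if "c \<in> C" for c using that C(1) M(1)[of c] by auto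
  have "cx_norm z \<le> B * cx_norm (cx_char S d z)" if "d \<in> K" for d z
  proof -
    obtain c where c: "c \<in> C" "cmod (c - d) < 1 / (2 * M c)"
      using C(3) \<open>d \<in> K\<close> by (auto simp: dist_norm)
    then have "c \<in> K" "0 < M c" using C(1) M(1) by auto
    have "cx_char S c z = cx_char S d z - cx_scale (c - d) z"
      by (simp add: cx.scale_left_diff_distrib)
    then have "cx_norm (cx_char S c z) \<le> cx_norm (cx_char S d z) + cmod (c - d) * cx_norm z"
      using cx_norm_triangle_diff[of "cx_char S d z" "cx_scale (c - d) z"]
      by (simp only: cx_norm_scale)
    also have "\<dots> \<le> cx_norm (cx_char S d z) + 1 / (2 * M c) * cx_norm z"
      using c(2) by (intro add_left_mono mult_right_mono) auto
    finally have "M c * cx_norm (cx_char S c z) \<le> M c * (cx_norm (cx_char S d z) + 1 / (2 * M c) * cx_norm z)"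
      using \<open>0 < M c\<close> by (intro mult_left_mono) auto
    also have "\<dots> = M c * cx_norm (cx_char S d z) + cx_norm z / 2"
      using \<open>0 < M c\<close> by (simp add: field_simps)
    \<comment> \<open>Half of \<open>cx_norm z\<close> is absorbed into the left-hand side.\<close>
    finally have "cx_norm z \<le> 2 * M c * cx_norm (cx_char S d z)"
      using M(2)[OF \<open>c \<in> K\<close>, of z] by simp
    also have "\<dots> \<le> B * cx_norm (cx_char S d z)"
      using member_le_sum[OF c(1), of "\<lambda>c. 2 * M c"] nonneg C(2)
      by (intro mult_right_mono) (auto simp: B_def)
    finally show ?thesis .
  qed
  moreover have "0 < B"
    using sum_nonneg[of C "\<lambda>c. 2 * M c"] nonneg by (simp add: B_def)
  ultimately show thesis by (intro that) auto
qed

section \<open>Powers and the spectrum\<close>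

lemma bij_cx_char: "c \<notin> op_spectrum S \<Longrightarrow> bij (cx_char S c)"
  by (erule not_in_op_spectrumE)

lemma cx_char_resolvent: "c \<notin> op_spectrum S \<Longrightarrow> cx_char S c (cx_resolvent S c z) = z"
  unfolding cx_resolvent_def by (rule surj_f_inv_f[OF bij_is_surj[OF bij_cx_char]])

lemma cx_resolvent_char: "c \<notin> op_spectrum S \<Longrightarrow> cx_resolvent S c (cx_char S c z) = z"
  unfolding cx_resolvent_def by (rule inv_f_f[OF bij_is_inj[OF bij_cx_char]])

text \<open>Divided by \<open>n\<close>, this is a Riemann sum for the contour integral of the
  resolvent over the circle of radius \<open>r\<close>, divided by \<open>2 pi i\<close>.\<close>

definition cx_circle_sum :: "('a::real_normed_vector \<Rightarrow> 'a) \<Rightarrow> real \<Rightarrow> nat \<Rightarrow> 'a \<times> 'a \<Rightarrow> 'a \<times> 'a" where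
  "cx_circle_sum S r n z =
     (\<Sum>k<n. cx_scale (circle_point r n k) (cx_resolvent S (circle_point r n k) z))"

text \<open>All points \<open>c\<close> of the circle satisfy \<open>c^n = r^n\<close>, so every
  resolvent cancels its factor in \<open>S^n - r^n\<close> and leaves \<open>cx_geom\<close>.
  Together with \<open>cx_circle_sum_right\<close> this expresses that the circle sum is
  \<open>n r^n (S^n - r^n)^(-1)\<close>, without presupposing that this inverse exists.\<close>

lemma cx_circle_sum_left:
  assumes S: "linear S" and n: "0 < n" and K: "\<And>k. circle_point r n k \<notin> op_spectrum S"
  shows "cx_circle_sum S r n (cx_extend (S ^^ n) z - cx_scale (of_real (r ^ n)) z)
       = cx_scale (of_nat n * of_real r ^ n) z"
proof -
  have "cx_resolvent S (circle_point r n k) (cx_extend (S ^^ n) z - cx_scale (of_real (r ^ n)) z)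
      = cx_geom S (circle_point r n k) n z" for k
    by (simp only: cx_resolvent_char[OF K] cx_geom_right[OF S, symmetric]
        circle_point_power[OF n, of r k, symmetric])
  then show ?thesis
    by (simp only: cx_circle_sum_def sum_cx_geom_circle[OF n S])
qed

lemma cx_circle_sum_right:
  assumes S: "linear S" and n: "0 < n" and K: "\<And>k. circle_point r n k \<notin> op_spectrum S"
  shows "cx_extend (S ^^ n) (cx_circle_sum S r n z) - cx_scale (of_real (r ^ n)) (cx_circle_sum S r n z)
       = cx_scale (of_nat n * of_real r ^ n) z"
proof -
  let ?c = "circle_point r n"
  note Sn = linear_funpow[OF S, of n]
  have *: "cx_extend (S ^^ n) w - cx_scale (of_real (r ^ n)) w = cx_geom S (?c k) n (cx_char S (?c k) w)" for k w
    by (simp only: cx_geom_left[OF S] circle_point_power[OF n, of r k, symmetric])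
  have geom: "cx_extend (S ^^ n) (cx_resolvent S (?c k) z)
      - cx_scale (of_real (r ^ n)) (cx_resolvent S (?c k) z) = cx_geom S (?c k) n z" for k
    using *[of "cx_resolvent S (?c k) z" k] by (simp only: cx_char_resolvent[OF K])
  let ?D = "\<lambda>w. cx_extend (S ^^ n) w - cx_scale (of_real (r ^ n)) w"
  have lin: "linear ?D"
    using linear_cx_extend[OF Sn] bounded_linear.linear[OF bounded_linear_cx_scale]
    by (rule linear_compose_sub)
  have "?D (cx_scale c w) = cx_scale c (?D w)" for c w
    by (simp add: cx_extend_scale[OF Sn] cx.scale_right_diff_distrib mult.commute)
  then show ?thesis
    by (simp only: cx_circle_sum_def linear_sum[OF lin] geom sum_cx_geom_circle[OF n S])
qed

lemma cmod_circle_point: "cmod (circle_point r n k) = \<bar>r\<bar>"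
  by (simp add: circle_point_def norm_mult)

lemma cmod_circle_point_diff: "cmod (circle_point r n k - circle_point s n k) = \<bar>r - s\<bar>"
  by (simp add: circle_point_def norm_mult flip: left_diff_distrib of_real_diff)

text \<open>Points with the same index \<open>k\<close> are at distance \<open>|r - s|\<close>, and
  each of the \<open>n\<close> terms is Lipschitz by
  \<open>c R(c) - d R(d) = (c - d) R(c) + d (R(c) - R(d))\<close>.\<close>

lemma cx_norm_circle_sum_diff:
  fixes S :: "'a::real_normed_vector \<Rightarrow> 'a"
  assumes S: "linear S" and K: "K \<inter> op_spectrum S = {}" and "0 \<le> M"
    and M: "\<And>c z. c \<in> K \<Longrightarrow> cx_norm z \<le> M * cx_norm (cx_char S c z)"
    and r: "\<And>k. circle_point r n k \<in> K" and s: "\<And>k. circle_point s n k \<in> K"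
  shows "cx_norm (cx_circle_sum S r n z - cx_circle_sum S s n z)
    \<le> n * (\<bar>r - s\<bar> * (M + \<bar>s\<bar> * M * M) * cx_norm z)"
proof -
  let ?c = "circle_point r n" and ?d = "circle_point s n"
  let ?R = "\<lambda>c. cx_resolvent S c z"
  have HR: "cx_char S c (?R c) = z" if "c \<in> K" for c
    using K that by (intro cx_char_resolvent) auto
  have R: "cx_norm (?R c) \<le> M * cx_norm z" if "c \<in> K" for c
    using M[OF that, of "?R c"] HR[OF that] by simp
  have "cx_norm (cx_scale (?c k) (?R (?c k)) - cx_scale (?d k) (?R (?d k)))
      \<le> \<bar>r - s\<bar> * (M + \<bar>s\<bar> * M * M) * cx_norm z" for k
  proof -
    let ?c = "?c k" and ?d = "?d k"
    \<comment> \<open>Resolvent identity, with \<open>S - c\<close> applied to it.\<close>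
    have "cx_char S ?c (?R ?c - ?R ?d) = cx_char S ?c (?R ?c) - cx_char S ?c (?R ?d)"
      by (rule linear_diff[OF linear_cx_char[OF S]])
    also have "\<dots> = cx_char S ?d (?R ?d) - cx_char S ?c (?R ?d)"
      by (simp only: HR r s)
    also have "\<dots> = cx_scale (?c - ?d) (?R ?d)"
      by (simp add: cx.scale_left_diff_distrib)
    finally have "cx_norm (?R ?c - ?R ?d) \<le> M * (\<bar>r - s\<bar> * cx_norm (?R ?d))"
      using M[OF r, of "?R ?c - ?R ?d" k] by (simp add: cx_norm_scale cmod_circle_point_diff)
    also have "\<dots> \<le> M * (\<bar>r - s\<bar> * (M * cx_norm z))"
      using \<open>0 \<le> M\<close> R[OF s] by (intro mult_left_mono) auto
    finally have diff: "cx_norm (?R ?c - ?R ?d) \<le> M * (\<bar>r - s\<bar> * (M * cx_norm z))" .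
    have "cx_scale ?c (?R ?c) - cx_scale ?d (?R ?d)
        = cx_scale (?c - ?d) (?R ?c) + cx_scale ?d (?R ?c - ?R ?d)"
      by (simp add: cx.scale_left_diff_distrib cx.scale_right_diff_distrib)
    then have "cx_norm (cx_scale ?c (?R ?c) - cx_scale ?d (?R ?d))
        \<le> \<bar>r - s\<bar> * cx_norm (?R ?c) + \<bar>s\<bar> * cx_norm (?R ?c - ?R ?d)"
      using cx_norm_triangle[of "cx_scale (?c - ?d) (?R ?c)" "cx_scale ?d (?R ?c - ?R ?d)"]
      by (simp add: cx_norm_scale cmod_circle_point cmod_circle_point_diff)
    also have "\<dots> \<le> \<bar>r - s\<bar> * (M * cx_norm z) + \<bar>s\<bar> * (M * (\<bar>r - s\<bar> * (M * cx_norm z)))"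
      using R[OF r] diff by (intro add_mono mult_left_mono) auto
    finally show ?thesis by (simp add: algebra_simps)
  qed
  then have "(\<Sum>k<n. cx_norm (cx_scale (?c k) (?R (?c k)) - cx_scale (?d k) (?R (?d k))))
      \<le> (\<Sum>k<n. \<bar>r - s\<bar> * (M + \<bar>s\<bar> * M * M) * cx_norm z)"
    by (intro sum_mono)
  then show ?thesis
    unfolding cx_circle_sum_def sum_subtractf[symmetric]
    using order_trans[OF cx_norm_sum_le] by fastforce
qed

lemma onorm_le_cx_norm:
  assumes "0 \<le> b" "\<And>z. cx_norm (cx_extend S z) \<le> b * cx_norm z"
  shows "onorm S \<le> b"
proof (rule onorm_bound[OF assms(1)])
  show "norm (S x) \<le> b * norm x" for x
    using norm_fst_le_cx_norm[of "cx_extend S (x, 0)"] assms(2)[of "(x, 0)"]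
    by (simp add: cx_norm_real) (simp add: cx_extend_def)
qed

text \<open>One exponent \<open>n\<close> with \<open>S^n/r^n\<close> small puts the circle sum for
  \<open>r\<close> near \<open>-n I\<close>. Closeness of the radii keeps the one for
  \<open>s\<close> near \<open>-n I\<close>, which makes \<open>S^n/s^n\<close> small again, and one
  exponent suffices for the limit.\<close>

lemma spectral_power_step:
  fixes S :: "'a::real_normed_vector \<Rightarrow> 'a"
  assumes S: "bounded_linear S" and K: "K \<inter> op_spectrum S = {}" and M0: "0 \<le> M"
    and M: "\<And>c z. c \<in> K \<Longrightarrow> cx_norm z \<le> M * cx_norm (cx_char S c z)"
    and r: "\<And>n k. circle_point r n k \<in> K" and s: "\<And>n k. circle_point s n k \<in> K"
    and pos: "0 < r" "0 < s" and close: "8 * (\<bar>r - s\<bar> * (M + s * M * M)) \<le> 1"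
    and lim: "(\<lambda>n. onorm (S ^^ n) / r ^ n) \<longlonglongrightarrow> 0"
  shows "(\<lambda>n. onorm (S ^^ n) / s ^ n) \<longlonglongrightarrow> 0"
proof -
  note lin = bounded_linear.linear[OF S]
  have "\<forall>\<^sub>F n in sequentially. onorm (S ^^ n) / r ^ n < 1 / 8 \<and> 0 < n"
    using lim by (intro eventually_conj order_tendstoD eventually_gt_at_top) auto
  then obtain n where n: "0 < n" "onorm (S ^^ n) / r ^ n < 1 / 8"
    by (auto dest!: eventually_happens)
  have Sn: "8 * onorm (S ^^ n) \<le> r ^ n"
    using n(2) pos by (simp add: field_simps)
  note Snb = bounded_linear_funpow[OF S, of n]
  have rK: "circle_point r n k \<notin> op_spectrum S" and sK: "circle_point s n k \<notin> op_spectrum S" for k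
    using K r s by blast+
  let ?V = "cx_circle_sum S"
  \<comment> \<open>\<open>cx_circle_sum_right\<close> gives \<open>r^n (V + n) u = S^n V u\<close>.
    Hence \<open>8 \<parallel>(V + n) u\<parallel> \<le> \<parallel>V u\<parallel>\<close>, and the
    triangle inequality removes \<open>V u\<close> from the right.\<close>
  have V: "7 * cx_norm (?V r n u + cx_scale (of_nat n) u) \<le> n * cx_norm u" for u
  proof -
    have "cx_scale (of_real (r ^ n)) (?V r n u + cx_scale (of_nat n) u) = cx_extend (S ^^ n) (?V r n u)"
      using cx_circle_sum_right[OF lin n(1) rK, of u]
      by (simp add: cx.scale_right_distrib algebra_simps)
    then have "r ^ n * cx_norm (?V r n u + cx_scale (of_nat n) u) \<le> onorm (S ^^ n) * cx_norm (?V r n u)"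
      using cx_norm_extend_le[OF Snb, of "?V r n u"] pos
        cx_norm_scale[of "of_real (r ^ n)" "?V r n u + cx_scale (of_nat n) u"]
      by (simp add: norm_power)
    then have "r ^ n * (8 * cx_norm (?V r n u + cx_scale (of_nat n) u)) \<le> (8 * onorm (S ^^ n)) * cx_norm (?V r n u)"
      by simp
    also have "\<dots> \<le> r ^ n * cx_norm (?V r n u)"
      using Sn by (intro mult_right_mono) auto
    finally have "8 * cx_norm (?V r n u + cx_scale (of_nat n) u) \<le> cx_norm (?V r n u)"
      using pos by simp
    also have "\<dots> \<le> cx_norm (?V r n u + cx_scale (of_nat n) u) + n * cx_norm u"
      using cx_norm_triangle_diff[of "?V r n u + cx_scale (of_nat n) u" "cx_scale (of_nat n) u"]
      by (simp add: cx_norm_scale)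
    finally show ?thesis by simp
  qed
  have diff: "8 * cx_norm (?V s n u - ?V r n u) \<le> n * cx_norm u" for u
  proof -
    have "cx_norm (?V s n u - ?V r n u) = cx_norm (?V r n u - ?V s n u)"
      using cx_norm_minus[of "?V s n u - ?V r n u"] by simp
    also have "\<dots> \<le> n * (\<bar>r - s\<bar> * (M + \<bar>s\<bar> * M * M) * cx_norm u)"
      by (rule cx_norm_circle_sum_diff[OF lin K M0 M r s])
    finally have "8 * cx_norm (?V s n u - ?V r n u) \<le> n * (8 * (\<bar>r - s\<bar> * (M + s * M * M)) * cx_norm u)"
      using pos by simp
    also have "\<dots> \<le> n * (1 * cx_norm u)"
      using close by (intro mult_left_mono mult_right_mono) auto
    finally show ?thesis by simp
  qed
  \<comment> \<open>The two errors add up to \<open>1/7 + 1/8 < 1/3\<close>.\<close>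
  have Vs: "cx_norm (?V s n u + cx_scale (of_nat n) u) \<le> 1 / 3 * (n * cx_norm u)" for u
  proof -
    have "cx_norm (?V s n u + cx_scale (of_nat n) u)
        \<le> cx_norm (?V r n u + cx_scale (of_nat n) u) + cx_norm (?V s n u - ?V r n u)"
      using cx_norm_triangle_sub[of "?V s n u + cx_scale (of_nat n) u" "?V r n u + cx_scale (of_nat n) u"]
      by simp
    moreover have "0 \<le> n * cx_norm u" by simp
    ultimately show ?thesis using V[of u] diff[of u] by linarith
  qed
  have "cx_norm (cx_extend (S ^^ n) z) \<le> s ^ n / 2 * cx_norm z" for z
  proof -
    let ?A = "cx_extend (S ^^ n) z"
    \<comment> \<open>For this \<open>u\<close> the circle sum is \<open>n s^n z\<close>, which
      cancels the part \<open>- s^n z\<close> of \<open>u\<close> and leaves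
      \<open>n S^n z\<close>.\<close>
    define u where "u = ?A - cx_scale (of_real (s ^ n)) z"
    have "?V s n u + cx_scale (of_nat n) u = cx_scale (of_nat n) ?A"
      unfolding u_def cx_circle_sum_left[OF lin n(1) sK]
      by (simp add: cx.scale_right_diff_distrib)
    then have "n * cx_norm ?A \<le> 1 / 3 * (n * cx_norm u)"
      using Vs[of u] by (simp only: cx_norm_scale norm_of_nat)
    then have "n * cx_norm ?A \<le> n * (1 / 3 * cx_norm u)"
      by (simp only: mult_ac)
    then have "cx_norm ?A \<le> 1 / 3 * cx_norm u"
      using n(1) by (simp only: mult_le_cancel_left_pos of_nat_0_less_iff)
    also have "cx_norm u \<le> cx_norm ?A + s ^ n * cx_norm z"
      using cx_norm_triangle_diff[of ?A "cx_scale (of_real (s ^ n)) z"] pos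
      by (simp add: u_def cx_norm_scale norm_power)
    finally show ?thesis by simp
  qed
  then have "onorm (S ^^ n) \<le> s ^ n / 2"
    using pos by (intro onorm_le_cx_norm) auto
  also have "\<dots> < s ^ n" using pos by simp
  finally show ?thesis
    using S n(1) pos(2) by (intro onorm_funpow_tendsto_0[of S n])
qed

text \<open>The radius descends from some \<open>R > \<parallel>S\<parallel>\<close>, where the
  limit is clear, to \<open>\<rho>\<close> in finitely many applications of
  \<open>spectral_power_step\<close>.\<close>

theorem onorm_funpow_tendsto_0_if_spectrum_subset_ball:
  fixes S :: "'a::banach \<Rightarrow> 'a"
  assumes S: "bounded_linear S" and "0 < \<rho>" and spec: "\<And>c. c \<in> op_spectrum S \<Longrightarrow> cmod c < \<rho>"
  shows "(\<lambda>n. onorm (S ^^ n) / \<rho> ^ n) \<longlonglongrightarrow> 0"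
proof -
  define R where "R = \<rho> + onorm S + 1"
  have R: "\<rho> \<le> R" "onorm S < R" using onorm_pos_le[OF S] \<open>0 < \<rho>\<close> by (auto simp: R_def)
  \<comment> \<open>Only the open ball is removed, so the circle of radius \<open>\<rho>\<close>
    lies in \<open>K\<close>; the strict bound in \<open>spec\<close> keeps the spectrum away from
    it.\<close>
  define K where "K = cball 0 R - ball (0 :: complex) \<rho>"
  have "compact K" unfolding K_def by (intro compact_diff) auto
  have K: "K \<inter> op_spectrum S = {}" using spec by (force simp: K_def)
  obtain M where M: "0 < M" "\<And>c z. c \<in> K \<Longrightarrow> cx_norm z \<le> M * cx_norm (cx_char S c z)"
    using cx_char_bounded_below_on_compact[OF \<open>compact K\<close> K] by blast
  have circle: "circle_point r n k \<in> K" if "\<rho> \<le> r" "r \<le> R" for r n k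
    using that \<open>0 < \<rho>\<close> by (simp add: K_def cmod_circle_point)
  \<comment> \<open>\<open>L\<close> bounds \<open>M + s * M * M\<close> for all radii
    \<open>s \<le> R\<close>, so one step length \<open>e\<close> meets the closeness condition
    throughout.\<close>
  define L where "L = M + R * M * M"
  have "0 < L" using M(1) R \<open>0 < \<rho>\<close> by (simp add: L_def add_pos_nonneg)
  define e where "e = 1 / (8 * L)"
  have "0 < e" using \<open>0 < L\<close> by (simp add: e_def)
  define r where "r k = max \<rho> (R - real k * e)" for k
  have r: "\<rho> \<le> r k" "r k \<le> R" "0 < r k" for k
    using R \<open>0 < e\<close> \<open>0 < \<rho>\<close> by (auto simp: r_def)
  have lim: "(\<lambda>n. onorm (S ^^ n) / r k ^ n) \<longlonglongrightarrow> 0" for k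
  proof (induction k)
    case 0
    have "r 0 = R" using R by (simp add: r_def)
    then show ?case using R \<open>0 < \<rho>\<close> by (intro onorm_funpow_tendsto_0[OF S, of 1]) auto
  next
    case (Suc k)
    show ?case
    proof (rule spectral_power_step[OF S K _ M(2) _ _ _ _ _ Suc])
      have "\<bar>r k - r (Suc k)\<bar> \<le> e"
        using \<open>0 < e\<close> by (auto simp: r_def max_def algebra_simps)
      then have "8 * (\<bar>r k - r (Suc k)\<bar> * L) \<le> 1"
        using \<open>0 < L\<close> by (simp add: e_def field_simps)
      moreover have "M + r (Suc k) * M * M \<le> L"
        using r[of "Suc k"] M(1) by (simp add: L_def mult_right_mono)
      then have "\<bar>r k - r (Suc k)\<bar> * (M + r (Suc k) * M * M) \<le> \<bar>r k - r (Suc k)\<bar> * L"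
        by (intro mult_left_mono) auto
      ultimately show "8 * (\<bar>r k - r (Suc k)\<bar> * (M + r (Suc k) * M * M)) \<le> 1"
        by linarith
    qed (use M(1) r circle in auto)
  qed
  obtain k :: nat where "R < k * e" using reals_Archimedean3[OF \<open>0 < e\<close>] by blast
  then have "r k = \<rho>" using \<open>0 < \<rho>\<close> by (simp add: r_def)
  then show ?thesis using lim[of k] by simp
qed

text \<open>
  An empty spectrum would make the supremum in \<^const>\<open>op_spectral_radius\<close> an unspecified real number.
  In that case the resolvent would be bounded near \<open>0\<close>, so that the circle sums divided by \<open>n\<close> tend
  to \<open>0\<close> with \<open>r\<close>, whereas for each fixed \<open>r > 0\<close> they tend to \<open>-I\<close> as \<open>n\<close> grows.
\<close>

theorem op_spectrum_nonempty:
  fixes S :: "'a::banach \<Rightarrow> 'a"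
  assumes S: "bounded_linear S" and x: "(x :: 'a) \<noteq> 0"
  shows "op_spectrum S \<noteq> {}"
proof
  assume empty: "op_spectrum S = {}"
  note lin = bounded_linear.linear[OF S]
  obtain M where M: "0 < M" "\<And>c z. c \<in> cball 0 1 \<Longrightarrow> cx_norm z \<le> M * cx_norm (cx_char S c z)"
    using cx_char_bounded_below_on_compact[of "cball 0 1" S] empty by auto
  \<comment> \<open>Chosen such that \<open>2 * (r * M) < 1\<close>; the argument below would force
    \<open>1 \<le> 2 * (r * M)\<close>.\<close>
  define r where "r = 1 / (1 + 2 * M)"
  have r: "0 < r" "r \<le> 1" "2 * (r * M) < 1" using M(1) by (auto simp: r_def field_simps)
  define z where "z = (x, 0 :: 'a)"
  have "cx_norm z > 0" using x by (simp add: z_def cx_norm_real)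
  \<comment> \<open>With empty spectrum the preceding theorem applies to every radius, however
    small.\<close>
  have "(\<lambda>n. onorm (S ^^ n) / r ^ n) \<longlonglongrightarrow> 0"
    using S r(1) empty by (intro onorm_funpow_tendsto_0_if_spectrum_subset_ball) auto
  then have "\<forall>\<^sub>F n in sequentially. onorm (S ^^ n) / r ^ n < 1 \<and> 0 < n"
    by (intro eventually_conj order_tendstoD eventually_gt_at_top) auto
  then obtain n where n: "0 < n" "onorm (S ^^ n) < r ^ n"
    using r by (auto dest!: eventually_happens)
  define u where "u = cx_extend (S ^^ n) z - cx_scale (of_real (r ^ n)) z"
  have "cx_norm u \<le> onorm (S ^^ n) * cx_norm z + r ^ n * cx_norm z"
    using cx_norm_triangle_diff[of "cx_extend (S ^^ n) z" "cx_scale (of_real (r ^ n)) z"] r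
      cx_norm_extend_le[OF bounded_linear_funpow[OF S], of n z]
    by (simp add: u_def cx_norm_scale norm_power)
  also have "\<dots> \<le> 2 * (r ^ n * cx_norm z)"
    using mult_right_mono[OF less_imp_le[OF n(2)] cx_norm_nonneg[of z]] by linarith
  finally have u: "cx_norm u \<le> 2 * (r ^ n * cx_norm z)" .
  have "cx_circle_sum S r n u = cx_scale (of_nat n * of_real r ^ n) z"
    unfolding u_def using empty by (intro cx_circle_sum_left lin n) simp
  then have "n * (r ^ n * cx_norm z) = cx_norm (cx_circle_sum S r n u)"
    using r by (simp add: cx_norm_scale norm_mult norm_power)
  also have "\<dots> \<le> (\<Sum>k<n. r * (M * cx_norm u))"
    unfolding cx_circle_sum_def
  proof (rule order_trans[OF cx_norm_sum_le sum_mono])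
    fix k
    have "cx_norm (cx_resolvent S (circle_point r n k) u) \<le> M * cx_norm u"
      using M(2)[of "circle_point r n k" "cx_resolvent S (circle_point r n k) u"] r
        cx_char_resolvent[of "circle_point r n k" S u] empty by (simp add: cmod_circle_point)
    then show "cx_norm (cx_scale (circle_point r n k) (cx_resolvent S (circle_point r n k) u)) \<le> r * (M * cx_norm u)"
      using r by (simp add: cx_norm_scale cmod_circle_point)
  qed
  also have "\<dots> = n * ((r * M) * cx_norm u)"
    by simp
  also have "\<dots> \<le> n * ((r * M) * (2 * (r ^ n * cx_norm z)))"
    using u r M(1) by (intro mult_left_mono) auto
  finally have "n * (1 * (r ^ n * cx_norm z)) \<le> n * (2 * (r * M) * (r ^ n * cx_norm z))"
    by (simp only: mult_ac mult_1_left)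
  then have "1 * (r ^ n * cx_norm z) \<le> 2 * (r * M) * (r ^ n * cx_norm z)"
    using n(1) by (simp only: mult_le_cancel_left_pos of_nat_0_less_iff)
  then have "1 \<le> 2 * (r * M)"
    using r \<open>cx_norm z > 0\<close> by (subst (asm) mult_le_cancel_right_pos) auto
  with r(3) show False by simp
qed

theorem op_spectral_radius_less_1_iff:
  fixes S :: "'a::banach \<Rightarrow> 'a"
  assumes S: "bounded_linear S" and x: "(x :: 'a) \<noteq> 0"
  shows "op_spectral_radius S < 1 \<longleftrightarrow> (\<lambda>n. onorm (S ^^ n)) \<longlonglongrightarrow> 0"
proof
  assume less: "op_spectral_radius S < 1"
  \<comment> \<open>Needed for the supremum to bound the elements of the spectrum.\<close>
  have "bdd_above (cmod ` op_spectrum S)"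
  proof (rule bdd_aboveI2)
    show "cmod c \<le> onorm S" if "c \<in> op_spectrum S" for c
      using not_in_op_spectrum_if_onorm_less[OF S, of 1 c] that by force
  qed
  then have "cmod c < 1" if "c \<in> op_spectrum S" for c
    using less that unfolding op_spectral_radius_def by (rule cSUP_lessD)
  then show "(\<lambda>n. onorm (S ^^ n)) \<longlonglongrightarrow> 0"
    using onorm_funpow_tendsto_0_if_spectrum_subset_ball[OF S, of 1] by simp
next
  assume "(\<lambda>n. onorm (S ^^ n)) \<longlonglongrightarrow> 0"
  then have "\<forall>\<^sub>F n in sequentially. onorm (S ^^ n) < 1/2 \<and> 0 < n"
    by (intro eventually_conj order_tendstoD eventually_gt_at_top) auto
  then obtain m where m: "0 < m" "onorm (S ^^ m) < 1/2"
    by (auto dest!: eventually_happens)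
  \<comment> \<open>A bound uniform in \<open>c\<close> is required, since \<open>cmod c < 1\<close>
    for each \<open>c\<close> alone would only give a supremum of at most 1.\<close>
  have "cmod c \<le> root m (1/2)" if "c \<in> op_spectrum S" for c
  proof -
    have "cmod c ^ m \<le> 1/2"
      using not_in_op_spectrum_if_onorm_less[OF S m(1), of c] that m(2) by force
    then have "root m (cmod c ^ m) \<le> root m (1/2)"
      using m(1) by simp
    then show ?thesis using m(1) by (simp add: real_root_power_cancel)
  qed
  then have "op_spectral_radius S \<le> root m (1/2)"
    unfolding op_spectral_radius_def using op_spectrum_nonempty[OF S x] by (intro cSUP_least)
  also have "\<dots> < 1" using m(1) by simp
  finally show "op_spectral_radius S < 1" .
qed

section \<open>Projections commuting with a Markov operator\<close>

context abstract_state_space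
begin

text \<open>In the zero space the base is empty, hence so is its hull, and the gauge is an infimum
  over the empty set, which is infinite in \<open>ereal\<close>. The non-zero vector is needed for
  \<open>op_spectrum_nonempty\<close>.\<close>

lemma nontrivial: "\<exists>x::'a. x \<noteq> 0"
proof (rule ccontr)
  assume "\<nexists>x::'a. x \<noteq> 0"
  then have zero: "x = 0" for x :: 'a by blast
  have "f x = 0" for x
    using zero[of x] linear_functional by (simp add: linear_0)
  then have "base_gauge f 0 = \<infinity>"
    by (simp add: base_gauge_def cone_base_def top_ereal_def)
  then show False using norm_eq_gauge[of 0] by simp
qed

text \<open>\<open>T\<close> maps the hull that defines the gauge into itself, so every scalar
  admissible for \<open>x\<close> is admissible for \<open>T x\<close>.\<close>

lemma markov_operator_norm_le:
  assumes T: "markov_operator f T"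
  shows "norm (T x) \<le> norm x"
proof -
  let ?U = "convex hull (cone_base f \<union> uminus ` cone_base f)"
  have lin: "linear T" and base: "T ` cone_base f \<subseteq> cone_base f"
    using T by (auto simp: markov_operator_def)
  have "T ` (cone_base f \<union> uminus ` cone_base f) \<subseteq> cone_base f \<union> uminus ` cone_base f"
    using base by (auto simp: linear_neg[OF lin])
  then have U: "T ` ?U \<subseteq> ?U"
    unfolding convex_hull_linear_image[OF lin] by (rule hull_mono)
  have "base_gauge f (T x) \<le> base_gauge f x"
    unfolding base_gauge_def
  proof (intro Inf_superset_mono image_mono subsetI CollectI conjI)
    fix l assume l: "l \<in> {l. 0 \<le> l \<and> x \<in> (*\<^sub>R) l ` ?U}"
    then show "0 \<le> l" by simp
    from l obtain u where "u \<in> ?U" "x = l *\<^sub>R u" by auto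
    then have "T u \<in> ?U" "T x = l *\<^sub>R T u" using U by (auto simp: linear_scale[OF lin])
    then show "T x \<in> (*\<^sub>R) l ` ?U" by blast
  qed
  then show ?thesis by (simp flip: norm_eq_gauge)
qed

lemma markov_operator_bounded_linear: "markov_operator f T \<Longrightarrow> bounded_linear T"
  using markov_operator_norm_le[of T]
  by (intro bounded_linear_intro[where K = 1]) (auto simp: markov_operator_def linear_add linear_scale)

end

text \<open>The sequence \<open>T^(n+1) x\<close> tends to \<open>P x\<close> as a shifted sequence
  and to \<open>T (P x)\<close> by continuity.\<close>

lemma uniformly_ergodic_imp_fixed:
  assumes P: "bounded_linear P" and T: "bounded_linear T" and erg: "uniformly_ergodic P T"
  shows "T \<circ> P = P"
proof
  fix x
  have bl: "bounded_linear (\<lambda>x. (T ^^ n) x - P x)" for n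
    by (rule bounded_linear_sub[OF bounded_linear_funpow[OF T] P])
  have lim: "(\<lambda>n. (T ^^ n) x) \<longlonglongrightarrow> P x"
  proof (rule Lim_null_comparison[THEN LIM_zero_cancel])
    show "\<forall>\<^sub>F n in sequentially. norm ((T ^^ n) x - P x) \<le> onorm (\<lambda>x. (T ^^ n) x - P x) * norm x"
      by (intro always_eventually allI onorm bl)
    show "(\<lambda>n. onorm (\<lambda>x. (T ^^ n) x - P x) * norm x) \<longlonglongrightarrow> 0"
      using erg unfolding uniformly_ergodic_def by (rule tendsto_mult_left_zero)
  qed
  have "(\<lambda>n. (T ^^ Suc n) x) \<longlonglongrightarrow> T (P x)"
    using bounded_linear.tendsto[OF T lim] by simp
  with LIMSEQ_Suc[OF lim] have "P x = T (P x)"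
    by (rule LIMSEQ_unique)
  then show "(T \<circ> P) x = P x" by simp
qed

text \<open>The situation once \<open>T P = P\<close> is known: commutation then gives
  \<open>P T = P\<close> too.\<close>

locale commuting_projection =
  fixes P T :: "'a::real_normed_vector \<Rightarrow> 'a"
  assumes P: "bounded_linear P" and T: "bounded_linear T"
    and PP: "P (P x) = P x" and TP: "T (P x) = P x" and PT: "P (T x) = P x"
begin

lemma funpow_fixes: "(T ^^ n) (P x) = P x"
  by (induction n) (simp_all add: TP)

lemma proj_funpow: "P ((T ^^ n) x) = P x"
  by (induction n) (simp_all add: PT)

text \<open>In \<open>(T - P) (T^n - P)\<close> every product containing \<open>P\<close> collapses
  to \<open>P\<close>. The identity starts at exponent 1, as the power 0 is \<open>I\<close> and not
  \<open>I - P\<close>.\<close>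

lemma funpow_diff: "0 < n \<Longrightarrow> ((\<lambda>x. T x - P x) ^^ n) x = (T ^^ n) x - P x"
proof (induction n)
  case (Suc n)
  show ?case
  proof (cases "n = 0")
    case False
    then show ?thesis
      using Suc bounded_linear.linear[OF T] bounded_linear.linear[OF P]
      by (simp add: linear_diff TP PP proj_funpow)
  qed simp
qed simp

lemma uniformly_ergodic_iff:
  "uniformly_ergodic P T \<longleftrightarrow> (\<lambda>n. onorm ((\<lambda>x. T x - P x) ^^ n)) \<longlonglongrightarrow> 0"
  unfolding uniformly_ergodic_def
proof (rule tendsto_cong)
  show "\<forall>\<^sub>F n in sequentially. onorm (\<lambda>x. (T ^^ n) x - P x) = onorm ((\<lambda>x. T x - P x) ^^ n)"
    using eventually_gt_at_top[of 0]
  proof eventually_elim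
    case (elim n)
    then have "(\<lambda>x. T x - P x) ^^ n = (\<lambda>x. (T ^^ n) x - P x)"
      by (intro ext funpow_diff)
    then show ?case by simp
  qed
qed

section \<open>The Dobrushin coefficient and ergodicity\<close>

lemma bdd_above_dobrushin: "bdd_above ((\<lambda>x. norm ((T ^^ n) x) / norm x) ` {x. P x = 0 \<and> x \<noteq> 0})"
  using onorm[OF bounded_linear_funpow[OF T], of n]
  by (intro bdd_aboveI2[where M = "onorm (T ^^ n)"]) (auto simp: field_simps)

lemma dobrushin_less_1_if_uniformly_ergodic:
  assumes "P \<noteq> id" "uniformly_ergodic P T"
  shows "\<exists>n. dobrushin_coeff P (T ^^ n) < 1"
proof -
  obtain y where "P y \<noteq> y" using assms(1) by (auto simp: fun_eq_iff)
  then have "y - P y \<in> {x. P x = 0 \<and> x \<noteq> 0}"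
    using bounded_linear.linear[OF P] by (simp add: linear_diff PP)
  then have ne: "{x. P x = 0 \<and> x \<noteq> 0} \<noteq> {}" by blast
  have "\<forall>\<^sub>F n in sequentially. onorm (\<lambda>x. (T ^^ n) x - P x) < 1"
    using assms(2) unfolding uniformly_ergodic_def by (rule order_tendstoD) simp
  then obtain n where n: "onorm (\<lambda>x. (T ^^ n) x - P x) < 1"
    by (auto dest!: eventually_happens)
  have "bounded_linear (\<lambda>x. (T ^^ n) x - P x)"
    by (rule bounded_linear_sub[OF bounded_linear_funpow[OF T] P])
  note bound = onorm[OF this]
  \<comment> \<open>On the kernel of \<open>P\<close> the operators \<open>T^n\<close> and
    \<open>T^n - P\<close> agree.\<close>
  have "norm ((T ^^ n) x) \<le> onorm (\<lambda>x. (T ^^ n) x - P x) * norm x" if "P x = 0" for x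
    using bound[of x] by (simp only: that diff_zero)
  then have "(SUP x\<in>{x. P x = 0 \<and> x \<noteq> 0}. norm ((T ^^ n) x) / norm x) \<le> onorm (\<lambda>x. (T ^^ n) x - P x)"
    by (intro cSUP_least ne) (auto simp: field_simps)
  then have "dobrushin_coeff P (T ^^ n) < 1"
    using n assms(1) by (simp add: dobrushin_coeff_def)
  then show ?thesis ..
qed

text \<open>The kernel of \<open>P\<close> is invariant under \<open>T\<close>, so
  \<open>T^(n k)\<close> contracts it by \<open>q^k\<close>. As
  \<open>(T - P)^(n k) = T^(n k) (I - P)\<close>, a large \<open>k\<close> beats the norm of
  \<open>I - P\<close>.\<close>

lemma uniformly_ergodic_if_dobrushin_less_1:
  assumes "P \<noteq> id" "dobrushin_coeff P (T ^^ n) < 1"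
  shows "uniformly_ergodic P T"
proof -
  define q where "q = dobrushin_coeff P (T ^^ n)"
  have contr: "norm ((T ^^ n) x) \<le> q * norm x" if "P x = 0" for x
  proof (cases "x = 0")
    case False
    then have "norm ((T ^^ n) x) / norm x \<le> q"
      unfolding q_def dobrushin_coeff_def using assms(1) that
      by (simp add: cSUP_upper[OF _ bdd_above_dobrushin])
    then show ?thesis using False by (simp add: field_simps)
  qed (simp add: linear_0[OF bounded_linear.linear[OF bounded_linear_funpow[OF T]]])
  have ker: "P (x - P x) = 0" for x
    using bounded_linear.linear[OF P] by (simp add: linear_diff PP)
  obtain y where "P y \<noteq> y" using assms(1) by (auto simp: fun_eq_iff)
  then have y: "0 < norm (y - P y)" by simp
  have "0 \<le> q"
    using order_trans[OF norm_ge_zero contr[OF ker[of y]]] y by (simp add: zero_le_mult_iff)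
  have "q < 1" using assms(2) by (simp add: q_def)
  \<comment> \<open>\<open>T^0\<close> is the identity and would force \<open>q \<ge> 1\<close> on
    the non-zero kernel vector \<open>y - P y\<close>.\<close>
  have "0 < n"
    using contr[OF ker[of y]] \<open>q < 1\<close> y by (cases "n = 0") auto
  have pow: "norm ((T ^^ (n * k)) x) \<le> q ^ k * norm x" if "P x = 0" for x k
  proof (induction k)
    case (Suc k)
    have "norm ((T ^^ (n * Suc k)) x) = norm ((T ^^ n) ((T ^^ (n * k)) x))"
      by (simp add: funpow_add)
    also have "\<dots> \<le> q * norm ((T ^^ (n * k)) x)"
      using that by (intro contr) (simp add: proj_funpow)
    also have "\<dots> \<le> q * (q ^ k * norm x)"
      using Suc \<open>0 \<le> q\<close> by (intro mult_left_mono)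
    finally show ?case by (simp add: mult.assoc)
  qed simp
  define B where "B = onorm (\<lambda>x. x - P x)"
  have IP: "bounded_linear (\<lambda>x. x - P x)"
    by (intro bounded_linear_sub bounded_linear_ident P)
  have "(\<lambda>k. q ^ k * B) \<longlonglongrightarrow> 0"
    using \<open>0 \<le> q\<close> \<open>q < 1\<close> by (intro tendsto_mult_left_zero LIMSEQ_power_zero) simp
  then have "\<forall>\<^sub>F k in sequentially. q ^ k * B < 1 \<and> 0 < k"
    by (intro eventually_conj order_tendstoD eventually_gt_at_top) auto
  then obtain k where k: "q ^ k * B < 1" "0 < k"
    by (auto dest!: eventually_happens)
  have m: "0 < n * k" using \<open>0 < n\<close> k by simp
  have "onorm ((\<lambda>x. T x - P x) ^^ (n * k)) \<le> q ^ k * B"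
  proof (rule onorm_bound)
    show "0 \<le> q ^ k * B"
      using \<open>0 \<le> q\<close> onorm_pos_le[OF IP] by (simp add: B_def)
    fix x
    have "((\<lambda>x. T x - P x) ^^ (n * k)) x = (T ^^ (n * k)) (x - P x)"
      using linear_diff[OF bounded_linear.linear[OF bounded_linear_funpow[OF T]]]
      by (simp add: funpow_diff[OF m] funpow_fixes)
    then have "norm (((\<lambda>x. T x - P x) ^^ (n * k)) x) \<le> q ^ k * norm (x - P x)"
      using pow[OF ker[of x]] by simp
    also have "\<dots> \<le> q ^ k * (B * norm x)"
      using onorm[OF IP] \<open>0 \<le> q\<close> by (intro mult_left_mono) (auto simp: B_def)
    finally show "norm (((\<lambda>x. T x - P x) ^^ (n * k)) x) \<le> q ^ k * B * norm x"
      by (simp add: mult.assoc)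
  qed
  then have "onorm ((\<lambda>x. T x - P x) ^^ (n * k)) < 1 ^ (n * k)"
    using k(1) by simp
  then show ?thesis
    using onorm_funpow_tendsto_0[OF bounded_linear_sub[OF T P] m, of 1]
    by (simp add: uniformly_ergodic_iff)
qed

end

text \<open>The Dobrushin equivalence is restricted to \<open>P \<noteq> id\<close>: the convention
  for \<open>P = id\<close> sets the coefficient to 1, although \<open>T = id\<close> is then
  uniformly ergodic.\<close>

theorem theorem3p4:
  fixes f :: "'a::{banach, ordered_real_vector} \<Rightarrow> real"
    and P T :: "'a \<Rightarrow> 'a"
  assumes "abstract_state_space f"
    and "is_projection P"
    and "markov_operator f T"
    and "P \<circ> T = T \<circ> P"
  shows "(P \<noteq> id \<longrightarrow>
            (uniformly_ergodic P T \<longleftrightarrow>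
              T \<circ> P = P \<and> (\<exists>n0. dobrushin_coeff P (T ^^ n0) < 1))) \<and>
         (uniformly_ergodic P T \<longleftrightarrow>
            T \<circ> P = P \<and> op_spectral_radius (\<lambda>x. T x - P x) < 1)"
proof -
  interpret abstract_state_space f by fact
  have T: "bounded_linear T" using assms(3) by (rule markov_operator_bounded_linear)
  have P: "bounded_linear P" "P \<circ> P = P" using assms(2) by (auto simp: is_projection_def)
  obtain x :: 'a where x: "x \<noteq> 0" using nontrivial by blast
  show ?thesis
  \<comment> \<open>Each of the three conditions contains or implies \<open>T \<circ> P = P\<close>,
    so all of them fail in the second case.\<close>
  proof (cases "T \<circ> P = P")
    case True
    interpret commuting_projection P T
    proof (rule commuting_projection.intro)
      show "P (P x) = P x" "T (P x) = P x" "P (T x) = P x" for x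
        using fun_cong[OF P(2), of x] fun_cong[OF True, of x] fun_cong[OF assms(4), of x] by auto
    qed (fact P T)+
    show ?thesis
      using True dobrushin_less_1_if_uniformly_ergodic uniformly_ergodic_if_dobrushin_less_1
        op_spectral_radius_less_1_iff[OF bounded_linear_sub[OF T P(1)] x] uniformly_ergodic_iff
      by blast
  next
    case False
    then show ?thesis using uniformly_ergodic_imp_fixed[OF P(1) T] by blast
  qed
qed

end
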